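(* Consider the problem $\min_{x\in\mathbb{R}^d} f(x)$ with $f=\frac1n\sum_{i=1}^n f_i$, solved using a distributed algorithm of the form given in the context, with matrices $A,B_u,B_v,C_y,C_z,D_{yu},D_{yv},D_{zu},D_{zv},F_x,F_u$. Suppose the local functions $f_i$ satisfy the function assumption (with constants $0<m\le L$) and the graph Laplacian matrices $\{\mathcal{L}^k\}_{k\ge0}$ satisfy the graph assumption (with constant $\sigma\in[0,1)$), both stated in the context, and further assume that the algorithm satisfies the fixed-point conditions $$\mathrm{null}(A-I)\cap\mathrm{row}(C_y)\cap\mathrm{null}(F_x)\neq\{0\}\qquad\text{and}\qquad \begin{bmatrix}B_u \\ D_{yu} \\ D_{zu}\end{bmatrix}\in\mathrm{col}\left(\begin{bmatrix}A-I \\ C_y \\ C_z\end{bmatrix}\right),$$ where $\mathrm{null}$, $\mathrm{row}$ and $\mathrm{col}$ denote the nullspace, row space and column space. Define $$M_0 = \begin{bmatrix} -2mL & L+m \\ L+m & -2\end{bmatrix},\qquad M_1=\begin{bmatrix}\sigma^2-1 & 1 \\ 1 & -1\end{bmatrix},$$ and let $\Psi$ be a matrix whose columns form a basis for the nullspace of $\begin{bmatrix}F_x & F_u\end{bmatrix}$. Let $\rho\ge0$ be a candidate linear rate. If there exist symmetric matrices $P\succ0$, $Q\succ0$ (both $p\times p$) and $R\succeq0$ ($c\times c$) such that $$\Psi^{\mathsf T}\begin{bmatrix} A & B_u \\ I & 0 \\ C_y & D_{yu} \\ 0 & I\end{bmatrix}^{\mathsf T}\begin{bmatrix}P&0&0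 \\ 0&-\rho^2P&0 \\ 0&0&M_0\end{bmatrix}\begin{bmatrix} A & B_u \\ I & 0 \\ C_y & D_{yu} \\ 0 & I\end{bmatrix}\Psi\preceq0$$ and $$\begin{bmatrix}A&B_u&B_v \\ I&0&0 \\ C_y&D_{yu}&D_{yv} \\ 0&I&0 \\ C_z&D_{zu}&D_{zv} \\ 0&0&I\end{bmatrix}^{\mathsf T}\begin{bmatrix}Q&0&0&0 \\ 0&-\rho^2Q&0&0 \\ 0&0&M_0&0 \\ 0&0&0&M_1\otimes R\end{bmatrix}\begin{bmatrix}A&B_u&B_v \\ I&0&0 \\ C_y&D_{yu}&D_{yv} \\ 0&I&0 \\ C_z&D_{zu}&D_{zv} \\ 0&0&I\end{bmatrix}\preceq0 ,$$ then, for every trajectory $(x_i^k,y_i^k,z_i^k,u_i^k,v_i^k)$ of the algorithm, there exists a constant $c_0>0$ independent of $i$ and $k$ such that for all agents $i\in\{1,\dots,n\}$ and all iterations $k\ge0$, $$\|x_i^k-x_i^\star\|\le c_0\,\rho^k$$ for some fixed point $(x_i^\star,y_i^\star,z_i^\star,u_i^\star,v_i^\star)_{i=1}^n$ of the algorithm that satisfies the consensus, optimality and robustness conditions defined in the context; in particular $y_i^\star=y_{\mathrm{opt}}$, $u_i^\star=\nabla f_i(y_{\mathrm{opt}})$ (so that $\sum_i u_i^\star=0$), $z_1^\star=\dots=z_n^\star$, and $v_i^\star=0$ for all $i$.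
   Context: **Function assumption.** $0<m\le L$ are given; each $f_i:\mathbb{R}^d\to\mathbb{R}$ is continuously differentiable and, for every $i$ and every $y\in\mathbb{R}^d$, $$\bigl(\nabla f_i(y)-\nabla f_i(y_{\mathrm{opt}})-m(y-y_{\mathrm{opt}})\bigr)^{\mathsf T}\bigl(\nabla f_i(y)-\nabla f_i(y_{\mathrm{opt}})-L(y-y_{\mathrm{opt}})\bigr)\le0 ,$$ where $y_{\mathrm{opt}}\in\mathbb{R}^d$ satisfies $\sum_{i=1}^n\nabla f_i(y_{\mathrm{opt}})=0$. **Graph assumption.** $1_n\in\mathbb{R}^n$ is the all-ones vector and $\Pi=\frac1n1_n1_n^{\mathsf T}$. At each iteration $k$ there is a graph $\mathcal{G}^k=(\{1,\dots,n\},\mathcal{E}^k)$, where $\mathcal E^k$ is the set of pairs of connected agents. An associated Laplacian matrix $\mathcal{L}^k\in\mathbb{R}^{n\times n}$ satisfies $\mathcal{L}^k1_n=0$ and $\mathcal{L}^k_{ij}=0$ whenever $i\ne j$ and $(i,j)\notin\mathcal{E}^k$. For every $k$: (1) the graph is connected (there is a path between any two nodes), so that the zero eigenvalue of $\mathcal{L}^k$ has multiplicity one; (2) the graph is balanced (every node has equal in-degree and out-degree), meaning $1_n^{\mathsf T}\mathcal{L}^k=0$; (3) $\|I-\Pi-\mathcal{L}^k\|\le\sigma$ in spectral norm, where $\sigma\in[0,1)$ is a constant independent of $k$. **Algorithm form.** Let $p$ be the number of local states per agent and $c$ the number of variables each agent communicates. The real matrices have sizes $A:p\times p$, $B_u:p\times1$,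 $B_v:p\times c$, $C_y:1\times p$, $D_{yu}:1\times1$, $D_{yv}:1\times c$, $C_z:c\times p$, $D_{zu}:c\times1$, $D_{zv}:c\times c$, $F_x:r\times p$, $F_u:r\times1$. A trajectory consists of $x_i^k\in\mathbb{R}^{p\times d}$, $y_i^k,u_i^k\in\mathbb{R}^{1\times d}$, $z_i^k,v_i^k\in\mathbb{R}^{c\times d}$ for $i=1,\dots,n$, $k\ge0$, satisfying for all $i,k$ $$\begin{bmatrix}x_i^{k+1} \\ y_i^k \\ z_i^k\end{bmatrix}=\begin{bmatrix}A&B_u&B_v \\ C_y&D_{yu}&D_{yv} \\ C_z&D_{zu}&D_{zv}\end{bmatrix}\begin{bmatrix}x_i^k \\ u_i^k \\ v_i^k\end{bmatrix},\quad u_i^k=\nabla f_i(y_i^k),\quad v_i^k=\sum_{j=1}^n\mathcal{L}^k_{ij}z_j^k,\quad \sum_{j=1}^n(F_xx_j^k+F_uu_j^k)=0,$$ where points of $\mathbb{R}^d$ are identified with row vectors in $\mathbb{R}^{1\times d}$ and $\nabla f_i$ is viewed as a map $\mathbb{R}^{1\times d}\to\mathbb{R}^{1\times d}$. The norm of $x_i^k$ is the Euclidean (Frobenius) norm. A fixed point is a tuple $(x_i^\star,y_i^\star,z_i^\star,u_i^\star,v_i^\star)_{i=1}^n$ satisfying these equations for all $k$ with $x_i^{k+1}=x_i^k=x_i^\star$ and $(y_i^k,z_i^k,u_i^k,v_i^k)=(y_i^\star,z_i^\star,u_i^\star,v_i^\star)$. **Consensus, optimality and robustness conditions on a fixed point.**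 Consensus and optimality: $y_1^\star=\dots=y_n^\star$ and $\sum_i u_i^\star=0$. Robustness to the graph: $z_1^\star=\dots=z_n^\star$ and $v_1^\star=\dots=v_n^\star=0$. Robustness to functions: $y_i^\star=y_{\mathrm{opt}}$ and $u_i^\star=\nabla f_i(y_{\mathrm{opt}})$ must be possible for any objective function, i.e. $\sum_i y_i^\star$ and the deviations of $u_1^\star,\dots,u_n^\star$ from their average are unconstrained by the algorithm. *)

theory Defs
  imports "HOL-Analysis.Analysis"
begin

text \<open>
  Matrices with \<open>r\<close> rows and \<open>s\<close> columns are elements of \<open>real ^ 's ^ 'r\<close>, so points of
  \<open>\<real>\<^sup>d\<close>, viewed as row vectors, have type \<open>real ^ 'd ^ 1\<close>. The norm of this type is the
  Frobenius norm. Block matrices are indexed by sum types, which associate to the right.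
\<close>

subsection \<open>Block matrices\<close>

definition hcat :: "real ^ 'a ^ 'r \<Rightarrow> real ^ 'b ^ 'r \<Rightarrow> real ^ ('a + 'b) ^ 'r"  (infixr "|||" 60)
  where "A ||| B = (\<chi> i j. case j of Inl a \<Rightarrow> A $ i $ a | Inr b \<Rightarrow> B $ i $ b)"

definition vcat :: "real ^ 's ^ 'a \<Rightarrow> real ^ 's ^ 'b \<Rightarrow> real ^ 's ^ ('a + 'b)"  (infixr "===" 55)
  where "A === B = (\<chi> i. case i of Inl a \<Rightarrow> A $ a | Inr b \<Rightarrow> B $ b)"

definition block_diag ::
    "real ^ 'a ^ 'r \<Rightarrow> real ^ 'b ^ 's \<Rightarrow> real ^ ('a + 'b) ^ ('r + 's)"  (infixr "\<oplus>" 65)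
  where "A \<oplus> B = ((A ||| 0) === (0 ||| B))"

text \<open>
  The Kronecker product with a left factor of size \<open>2 \<times> 2\<close>, in block form. The index type
  \<open>1 + 1\<close> is used for such matrices so that they also fit into block matrices directly.
\<close>

definition kronecker2 ::
    "real ^ (1 + 1) ^ (1 + 1) \<Rightarrow> real ^ 'a ^ 'b \<Rightarrow> real ^ ('a + 'a) ^ ('b + 'b)"
  where "kronecker2 M R =
    ((M $ Inl 1 $ Inl 1 *\<^sub>R R ||| M $ Inl 1 $ Inr 1 *\<^sub>R R) ===
     (M $ Inr 1 $ Inl 1 *\<^sub>R R ||| M $ Inr 1 $ Inr 1 *\<^sub>R R))"

text \<open>\<open>mat a\<close> is \<open>a\<close> times the identity, here a \<open>1 \<times> 1\<close> matrix.\<close>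

definition M0 :: "real \<Rightarrow> real \<Rightarrow> real ^ (1 + 1) ^ (1 + 1)"
  where "M0 m L = ((mat (- 2 * m * L) ||| mat (L + m)) === (mat (L + m) ||| mat (- 2)))"

definition M1 :: "real \<Rightarrow> real ^ (1 + 1) ^ (1 + 1)"
  where "M1 \<sigma> = ((mat (\<sigma>\<^sup>2 - 1) ||| mat 1) === (mat 1 ||| mat (- 1)))"

definition pos_def_matrix :: "real ^ 'a ^ 'a \<Rightarrow> bool"
  where "pos_def_matrix M \<longleftrightarrow> transpose M = M \<and> (\<forall>w. w \<noteq> 0 \<longrightarrow> w \<bullet> (M *v w) > 0)"

definition pos_semidef_matrix :: "real ^ 'a ^ 'a \<Rightarrow> bool"
  where "pos_semidef_matrix M \<longleftrightarrow> transpose M = M \<and> (\<forall>w. w \<bullet> (M *v w) \<ge> 0)"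

definition neg_semidef_matrix :: "real ^ 'a ^ 'a \<Rightarrow> bool"
  where "neg_semidef_matrix M \<longleftrightarrow> transpose M = M \<and> (\<forall>w. w \<bullet> (M *v w) \<le> 0)"

definition null_space :: "real ^ 'a ^ 'b \<Rightarrow> (real ^ 'a) set"
  where "null_space M = {w. M *v w = 0}"

definition row_space :: "real ^ 'a ^ 'b \<Rightarrow> (real ^ 'a) set"
  where "row_space M = span (rows M)"

definition col_space :: "real ^ 'a ^ 'b \<Rightarrow> (real ^ 'b) set"
  where "col_space M = span (columns M)"

text \<open>Injectivity is needed because \<open>columns\<close> is a set and forgets repeated columns.\<close>

definition columns_form_basis :: "real ^ 'a ^ 'b \<Rightarrow> (real ^ 'b) set \<Rightarrow> bool"
  where "columns_form_basis M V \<longleftrightarrow>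
    inj (\<lambda>j. column j M) \<and> independent (columns M) \<and> span (columns M) = V"

subsection \<open>Local functions\<close>

definition grad :: "(real ^ 'd \<Rightarrow> real) \<Rightarrow> real ^ 'd \<Rightarrow> real ^ 'd"
  where "grad f w = (THE g. GDERIV f w :> g)"

definition continuously_differentiable :: "(real ^ 'd \<Rightarrow> real) \<Rightarrow> bool"
  where "continuously_differentiable f \<longleftrightarrow>
    (\<forall>w. f differentiable (at w)) \<and> continuous_on UNIV (grad f)"

definition function_assumption ::
    "real \<Rightarrow> real \<Rightarrow> ('n::finite \<Rightarrow> real ^ 'd \<Rightarrow> real) \<Rightarrow> real ^ 'd \<Rightarrow> bool"
  where "function_assumption m L f yopt \<longleftrightarrow>
    0 < m \<and> m \<le> L \<and>
    (\<forall>i. continuously_differentiable (f i)) \<and>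
    (\<Sum>i\<in>UNIV. grad (f i) yopt) = 0 \<and>
    (\<forall>i y. (grad (f i) y - grad (f i) yopt - m *\<^sub>R (y - yopt)) \<bullet>
           (grad (f i) y - grad (f i) yopt - L *\<^sub>R (y - yopt)) \<le> 0)"

definition row_vec :: "real ^ 'd \<Rightarrow> real ^ 'd ^ 1"
  where "row_vec w = (\<chi> _. w)"

definition grad_row :: "(real ^ 'd \<Rightarrow> real) \<Rightarrow> real ^ 'd ^ 1 \<Rightarrow> real ^ 'd ^ 1"
  where "grad_row f y = row_vec (grad f (y $ 1))"

subsection \<open>Communication graphs\<close>

definition averaging_matrix :: "real ^ 'n ^ 'n"
  where "averaging_matrix = (\<chi> i j. 1 / real CARD('n))"

text \<open>
  Edges are ordered pairs. The condition \<open>1 v* Lap k = 0\<close> says that the graph is balanced: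
  as the rows of \<open>Lap k\<close> sum to zero, it equates the weighted in-degree and out-degree of every
  node.
\<close>

definition graph_assumption ::
    "real \<Rightarrow> (nat \<Rightarrow> ('n \<times> 'n) set) \<Rightarrow> (nat \<Rightarrow> real ^ 'n ^ 'n) \<Rightarrow> bool"
  where "graph_assumption \<sigma> E Lap \<longleftrightarrow>
    0 \<le> \<sigma> \<and> \<sigma> < 1 \<and>
    (\<forall>k. Lap k *v 1 = 0 \<and>
         (\<forall>i j. i \<noteq> j \<and> (i, j) \<notin> E k \<longrightarrow> Lap k $ i $ j = 0) \<and>
         (\<forall>i j. (i, j) \<in> (E k)\<^sup>*) \<and>
         1 v* Lap k = 0 \<and>
         onorm (\<lambda>w. (mat 1 - averaging_matrix - Lap k) *v w) \<le> \<sigma>)"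

text \<open>
  The zero eigenvalue of each Laplacian has multiplicity one, geometrically and (as there are no
  generalised eigenvectors) algebraically.
\<close>

lemma graph_assumption_zero_eigenvalue:
  fixes Lap :: "nat \<Rightarrow> real ^ 'n ^ 'n"
  assumes "graph_assumption \<sigma> E Lap"
  shows "null_space (Lap k) = span {1}"
    and "null_space (Lap k ** Lap k) = null_space (Lap k)"
proof -
  let ?M = "mat 1 - averaging_matrix - Lap k"
  from assms have one: "Lap k *v 1 = 0" and bal: "1 v* Lap k = 0" and \<sigma>: "\<sigma> < 1"
    and bd: "onorm (\<lambda>w. ?M *v w) \<le> \<sigma>"
    by (auto simp: graph_assumption_def)
  have avg: "averaging_matrix *v w = ((\<Sum>j\<in>UNIV. w $ j) / real CARD('n)) *\<^sub>R (1 :: real ^ 'n)"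
    for w :: "real ^ 'n"
    by (simp add: vec_eq_iff averaging_matrix_def matrix_vector_mult_def sum_divide_distrib)
  show null: "null_space (Lap k) = span {1}"
  proof (intro equalityI subsetI)
    fix w assume "w \<in> null_space (Lap k)"
    then have w: "Lap k *v w = 0" by (simp add: null_space_def)
    define a where "a = (\<Sum>j\<in>UNIV. w $ j) / real CARD('n)"
    define w' where "w' = w - a *\<^sub>R 1"
    have "(\<Sum>j\<in>UNIV. w' $ j) = 0"
      by (simp add: w'_def a_def sum_subtractf)
    then have "averaging_matrix *v w' = 0" by (simp add: avg)
    moreover have "Lap k *v w' = 0"
      by (simp add: w'_def matrix_vector_mult_diff_distrib matrix_vector_mult_scaleR w one)
    ultimately have "?M *v w' = w'"
      by (simp add: matrix_vector_mult_diff_rdistrib)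
    moreover have "norm (?M *v w') \<le> onorm (\<lambda>w. ?M *v w) * norm w'"
      by (rule onorm) simp
    ultimately have "norm w' \<le> \<sigma> * norm w'"
      using mult_right_mono[OF bd norm_ge_zero[of w']] by simp
    then have "(1 - \<sigma>) * norm w' \<le> 0"
      by (simp add: algebra_simps)
    then have "w' = 0"
      using \<sigma> by (simp add: mult_le_0_iff)
    then show "w \<in> span {1}" by (auto simp: w'_def span_singleton)
  next
    fix w :: "real ^ 'n" assume "w \<in> span {1}"
    then show "w \<in> null_space (Lap k)"
      by (auto simp: null_space_def span_singleton matrix_vector_mult_scaleR one)
  qed
  show "null_space (Lap k ** Lap k) = null_space (Lap k)"
  proof (intro equalityI subsetI)
    fix w assume "w \<in> null_space (Lap k ** Lap k)"
    then have "Lap k *v w \<in> span {1}"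
      by (simp add: null[symmetric] null_space_def matrix_vector_mul_assoc)
    then obtain a where a: "Lap k *v w = a *\<^sub>R 1" by (auto simp: span_singleton)
    have "1 \<bullet> (Lap k *v w) = 0"
      by (simp add: dot_lmul_matrix[symmetric] bal)
    then have "a = 0" by (simp add: a inner_vec_def)
    then show "w \<in> null_space (Lap k)" by (simp add: null_space_def a)
  next
    fix w assume "w \<in> null_space (Lap k)"
    then show "w \<in> null_space (Lap k ** Lap k)"
      by (simp add: null_space_def matrix_vector_mul_assoc[symmetric])
  qed
qed

subsection \<open>The algorithm and its fixed points\<close>

text \<open>
  \<open>S\<close> is the full system matrix with blocks \<open>A\<close> to \<open>Dzv\<close>. All iterates take the iteration
  as first and the agent as second argument. The relation between \<open>u\<close> and the local functions is
  kept separate, because robustness to functions refers to the remaining equations only.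
\<close>

definition algorithm_equations ::
    "real ^ ('p::finite + (1 + 'c::finite)) ^ ('p + (1 + 'c)) \<Rightarrow> real ^ 'p ^ 'r \<Rightarrow> real ^ 1 ^ 'r \<Rightarrow>
     (nat \<Rightarrow> real ^ 'n ^ 'n) \<Rightarrow>
     (nat \<Rightarrow> 'n \<Rightarrow> real ^ 'd ^ 'p) \<Rightarrow> (nat \<Rightarrow> 'n \<Rightarrow> real ^ 'd ^ 1) \<Rightarrow> (nat \<Rightarrow> 'n \<Rightarrow> real ^ 'd ^ 'c) \<Rightarrow>
     (nat \<Rightarrow> 'n \<Rightarrow> real ^ 'd ^ 1) \<Rightarrow> (nat \<Rightarrow> 'n \<Rightarrow> real ^ 'd ^ 'c) \<Rightarrow> bool"
  where "algorithm_equations S Fx Fu Lap x y z u v \<longleftrightarrow>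
    (\<forall>k i. (x (Suc k) i === y k i === z k i) = S ** (x k i === u k i === v k i)) \<and>
    (\<forall>k i. v k i = (\<Sum>j\<in>UNIV. Lap k $ i $ j *\<^sub>R z k j)) \<and>
    (\<forall>k. (\<Sum>j\<in>UNIV. Fx ** x k j + Fu ** u k j) = 0)"

definition trajectory ::
    "real ^ ('p::finite + (1 + 'c::finite)) ^ ('p + (1 + 'c)) \<Rightarrow> real ^ 'p ^ 'r \<Rightarrow> real ^ 1 ^ 'r \<Rightarrow>
     ('n \<Rightarrow> real ^ 'd \<Rightarrow> real) \<Rightarrow> (nat \<Rightarrow> real ^ 'n ^ 'n) \<Rightarrow>
     (nat \<Rightarrow> 'n \<Rightarrow> real ^ 'd ^ 'p) \<Rightarrow> (nat \<Rightarrow> 'n \<Rightarrow> real ^ 'd ^ 1) \<Rightarrow> (nat \<Rightarrow> 'n \<Rightarrow> real ^ 'd ^ 'c) \<Rightarrow>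
     (nat \<Rightarrow> 'n \<Rightarrow> real ^ 'd ^ 1) \<Rightarrow> (nat \<Rightarrow> 'n \<Rightarrow> real ^ 'd ^ 'c) \<Rightarrow> bool"
  where "trajectory S Fx Fu f Lap x y z u v \<longleftrightarrow>
    algorithm_equations S Fx Fu Lap x y z u v \<and> (\<forall>k i. u k i = grad_row (f i) (y k i))"

definition fixed_point ::
    "real ^ ('p::finite + (1 + 'c::finite)) ^ ('p + (1 + 'c)) \<Rightarrow> real ^ 'p ^ 'r \<Rightarrow> real ^ 1 ^ 'r \<Rightarrow>
     ('n \<Rightarrow> real ^ 'd \<Rightarrow> real) \<Rightarrow> (nat \<Rightarrow> real ^ 'n ^ 'n) \<Rightarrow>
     ('n \<Rightarrow> real ^ 'd ^ 'p) \<Rightarrow> ('n \<Rightarrow> real ^ 'd ^ 1) \<Rightarrow> ('n \<Rightarrow> real ^ 'd ^ 'c) \<Rightarrow>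
     ('n \<Rightarrow> real ^ 'd ^ 1) \<Rightarrow> ('n \<Rightarrow> real ^ 'd ^ 'c) \<Rightarrow> bool"
  where "fixed_point S Fx Fu f Lap xs ys zs us vs \<longleftrightarrow>
    trajectory S Fx Fu f Lap (\<lambda>_. xs) (\<lambda>_. ys) (\<lambda>_. zs) (\<lambda>_. us) (\<lambda>_. vs)"

definition consensus_optimal :: "('n::finite \<Rightarrow> real ^ 'd ^ 1) \<Rightarrow> ('n \<Rightarrow> real ^ 'd ^ 1) \<Rightarrow> bool"
  where "consensus_optimal ys us \<longleftrightarrow> (\<forall>i j. ys i = ys j) \<and> (\<Sum>i\<in>UNIV. us i) = 0"

definition robust_to_graph :: "('n \<Rightarrow> real ^ 'd ^ 'c) \<Rightarrow> ('n \<Rightarrow> real ^ 'd ^ 'c) \<Rightarrow> bool"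
  where "robust_to_graph zs vs \<longleftrightarrow> (\<forall>i j. zs i = zs j) \<and> (\<forall>i. vs i = 0)"

text \<open>
  Robustness to functions is a property of the algorithm: among the constant solutions of its
  equations that meet the conditions above, the sum \<open>s\<close> of the \<open>ys i\<close> and the deviations
  \<open>\<delta> i\<close> of the \<open>us i\<close> from their average can be prescribed arbitrarily (deviations necessarily
  sum to zero). The type argument fixes the dimension of the decision variable.
\<close>

definition robust_to_functions ::
    "'d::finite itself \<Rightarrow> real ^ ('p::finite + (1 + 'c::finite)) ^ ('p + (1 + 'c)) \<Rightarrow> real ^ 'p ^ 'r \<Rightarrow> real ^ 1 ^ 'r \<Rightarrow>
     (nat \<Rightarrow> real ^ 'n ^ 'n) \<Rightarrow> bool"
  where "robust_to_functions d S Fx Fu Lap \<longleftrightarrow>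
    (\<forall>(s :: real ^ 'd ^ 1) (\<delta> :: 'n \<Rightarrow> real ^ 'd ^ 1). (\<Sum>i\<in>UNIV. \<delta> i) = 0 \<longrightarrow>
      (\<exists>xs ys zs us vs.
        algorithm_equations S Fx Fu Lap (\<lambda>_. xs) (\<lambda>_. ys) (\<lambda>_. zs) (\<lambda>_. us) (\<lambda>_. vs) \<and>
        consensus_optimal ys us \<and> robust_to_graph zs vs \<and>
        (\<Sum>i\<in>UNIV. ys i) = s \<and>
        (\<forall>i. us i - (1 / real CARD('n)) *\<^sub>R (\<Sum>j\<in>UNIV. us j) = \<delta> i)))"

text \<open>So the optimum of any objective function is attained at some fixed point.\<close>

lemma robust_to_functions_any_objective:
  fixes f :: "'n::finite \<Rightarrow> real ^ 'd \<Rightarrow> real"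
  assumes "robust_to_functions TYPE('d) S Fx Fu Lap"
    and "(\<Sum>i\<in>UNIV. grad (f i) yopt) = 0"
  shows "\<exists>xs ys zs us vs. fixed_point S Fx Fu f Lap xs ys zs us vs \<and> robust_to_graph zs vs \<and>
    (\<forall>i. ys i = row_vec yopt) \<and> (\<forall>i. us i = row_vec (grad (f i) yopt))"
proof -
  let ?\<delta> = "\<lambda>i. row_vec (grad (f i) yopt)"
  let ?s = "real CARD('n) *\<^sub>R row_vec yopt"
  have \<delta>: "(\<Sum>i\<in>UNIV. ?\<delta> i) = 0"
    using assms(2) by (simp add: vec_eq_iff row_vec_def)
  from assms(1)[unfolded robust_to_functions_def, rule_format, OF \<delta>, of ?s]
  obtain xs ys zs us vs where
    eqs: "algorithm_equations S Fx Fu Lap (\<lambda>_. xs) (\<lambda>_. ys) (\<lambda>_. zs) (\<lambda>_. us) (\<lambda>_. vs)"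
    and co: "consensus_optimal ys us" and gr: "robust_to_graph zs vs"
    and s: "(\<Sum>i\<in>UNIV. ys i) = ?s"
    and dev: "\<And>i. us i - (1 / real CARD('n)) *\<^sub>R (\<Sum>j\<in>UNIV. us j) = ?\<delta> i"
    by blast
  have us: "us i = ?\<delta> i" for i
    using dev[of i] co by (simp add: consensus_optimal_def)
  have ys: "ys i = row_vec yopt" for i
  proof -
    have "(\<Sum>j\<in>UNIV. ys j) = (\<Sum>j\<in>(UNIV :: 'n set). ys i)"
      using co by (intro sum.cong) (auto simp: consensus_optimal_def)
    with s show ?thesis by (simp add: sum_constant_scaleR del: sum_constant)
  qed
  have "fixed_point S Fx Fu f Lap xs ys zs us vs"
    using eqs by (simp add: fixed_point_def trajectory_def us ys grad_row_def row_vec_def)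
  with gr us ys show ?thesis by blast
qed

end

theory Submission
  imports Defs
begin

text \<open>
  The fixed-point conditions yield \<open>w\<close> and \<open>h\<close> such that \<open>x\<^sub>i = w y - h u\<^sub>i\<close> is a fixed point for
  every common \<open>y\<close> and all \<open>u\<^sub>i\<close> with sum zero. The deviation of a trajectory from the fixed point at
  \<open>y\<^sub>o\<^sub>p\<^sub>t\<close> is split into its average over the agents, which the Laplacians do not affect and which
  obeys the invariant \<open>F\<^sub>x x + F\<^sub>u u = 0\<close>, and the disagreement with that average. The first
  matrix inequality applies to the average and the second one to the disagreement of each agent;
  each of the two parts alone need not satisfy the sector bound, but their total does. Hence the
  sum of both quadratic forms contracts by \<open>\<rho>\<^sup>2\<close>. The Laplacian term has the right sign for all
  positive semidefinite \<open>R\<close> because \<open>R\<close> is a sum of squares of linear forms, which reduces it to the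
  scalar bound on \<open>I - \<Pi> - \<L>\<^sup>k\<close>.
\<close>

section \<open>Block matrices, matrix arithmetic and the Frobenius inner product\<close>

lemma sum_UNIV_Plus:
  fixes g :: "'a::finite + 'b::finite \<Rightarrow> 'c::comm_monoid_add"
  shows "(\<Sum>i\<in>UNIV. g i) = (\<Sum>i\<in>UNIV. g (Inl i)) + (\<Sum>i\<in>UNIV. g (Inr i))"
  using sum.Plus[of "UNIV :: 'a set" "UNIV :: 'b set" g] by simp

lemma vec_sum_eq_iff:
  fixes X Y :: "'c ^ ('a::finite + 'b::finite)"
  shows "X = Y \<longleftrightarrow> (\<forall>i. X $ Inl i = Y $ Inl i) \<and> (\<forall>i. X $ Inr i = Y $ Inr i)"
  by (metis vec_eq_iff sum.exhaust)

lemma hcat_nth [simp]: "(A ||| B) $ i $ Inl a = A $ i $ a" "(A ||| B) $ i $ Inr b = B $ i $ b"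
  by (simp_all add: hcat_def)

lemma vcat_nth [simp]: "(A === B) $ Inl a = A $ a" "(A === B) $ Inr b = B $ b"
  by (simp_all add: vcat_def)

lemma vcat_eq_iff: "(A === B) = (C === D) \<longleftrightarrow> A = C \<and> B = D"
  by (simp add: vec_sum_eq_iff) (simp add: vec_eq_iff)

lemma inner_vcat: "(A === B) \<bullet> (C === D) = A \<bullet> C + B \<bullet> D"
  by (simp add: inner_vec_def sum_UNIV_Plus)

lemma vcat_mult: "(A === B) ** C = (A ** C === B ** C)"
  by (simp add: vec_sum_eq_iff) (simp add: vec_eq_iff matrix_matrix_mult_def)

lemma hcat_mult_vcat: "(A ||| B) ** (C === D) = A ** C + B ** D"
  by (simp add: vec_eq_iff matrix_matrix_mult_def sum_UNIV_Plus)

lemma matrix_mult_minus_left: "(- A) ** B = - (A ** B)" for A :: "real ^ 'a ^ 'b"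
  by (simp add: vec_eq_iff matrix_matrix_mult_def sum_negf)

lemma matrix_mult_add_left: "(A + B) ** C = A ** C + B ** C" for A :: "real ^ 'a ^ 'b"
  by (simp add: vec_eq_iff matrix_matrix_mult_def sum.distrib distrib_right)

lemma matrix_mult_diff_left: "(A - B) ** C = A ** C - B ** C" for A :: "real ^ 'a ^ 'b"
  by (simp add: vec_eq_iff matrix_matrix_mult_def sum_subtractf left_diff_distrib)

lemma matrix_mult_diff_right: "A ** (B - C) = A ** B - A ** C" for A :: "real ^ 'a ^ 'b"
  by (simp add: vec_eq_iff matrix_matrix_mult_def sum_subtractf right_diff_distrib)

lemma matrix_mult_scaleR_left: "(c *\<^sub>R A) ** B = c *\<^sub>R (A ** B)" for A :: "real ^ 'a ^ 'b"
  by (simp add: vec_eq_iff matrix_matrix_mult_def sum_distrib_left mult.assoc)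

lemma matrix_mult_scaleR_right: "A ** (c *\<^sub>R B) = c *\<^sub>R (A ** B)" for A :: "real ^ 'a ^ 'b"
  by (simp add: vec_eq_iff matrix_matrix_mult_def sum_distrib_left ac_simps)

lemma matrix_mult_zero_left: "0 ** B = 0" for B :: "real ^ 'a ^ 'b"
  by (simp add: vec_eq_iff matrix_matrix_mult_def)

lemma matrix_mult_zero_right: "A ** 0 = 0" for A :: "real ^ 'a ^ 'b"
  by (simp add: vec_eq_iff matrix_matrix_mult_def)

lemma matrix_mult_sum_right: "A ** (\<Sum>i\<in>I. B i) = (\<Sum>i\<in>I. A ** B i)" for A :: "real ^ 'a ^ 'b"
  by (induction I rule: infinite_finite_induct)
    (simp_all add: matrix_mult_zero_right matrix_add_ldistrib)

lemma mat_1x1_mult: "mat c ** B = c *\<^sub>R B" for B :: "real ^ 'a ^ 1"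
  by (simp add: vec_eq_iff matrix_matrix_mult_def mat_def)

lemma column_matrix_mult: "column j (A ** B) = A *v column j B"
  by (simp add: vec_eq_iff column_def matrix_matrix_mult_def matrix_vector_mult_def)

lemma inner_columns: "X \<bullet> Y = (\<Sum>j\<in>UNIV. column j X \<bullet> column j Y)" for X Y :: "real ^ 'a ^ 'b"
  unfolding inner_vec_def column_def by (simp add: sum.swap[of _ UNIV "UNIV :: 'b set"])

lemma inner_matrix_mult_transpose: "X \<bullet> (transpose T ** Y) = (T ** X) \<bullet> Y"
  for T :: "real ^ 'a ^ 'b"
  unfolding inner_columns column_matrix_mult
  by (metis (no_types) dot_lmul_matrix inner_commute transpose_matrix_vector)

lemma norm_matrix_mult_le:
  fixes W :: "real ^ 'n ^ 'm"
  shows "norm (W *v w) \<le> onorm ((*v) W) * norm w"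
  by (rule onorm) simp

section \<open>Quadratic forms evaluated on matrices\<close>

text \<open>This is the trace of \<open>X^T M X\<close>. As it is the sum of the vector form over
  the columns of \<open>X\<close>, matrix inequalities formulated for vectors apply to states with
  several columns.\<close>

definition quadform :: "real ^ 'a ^ 'a \<Rightarrow> real ^ 'b ^ 'a \<Rightarrow> real"
  where "quadform M X = X \<bullet> (M ** X)"

lemma quadform_columns: "quadform M X = (\<Sum>j\<in>UNIV. column j X \<bullet> (M *v column j X))"
  by (simp add: quadform_def inner_columns column_matrix_mult)

lemma quadform_neg_semidef: "neg_semidef_matrix M \<Longrightarrow> quadform M X \<le> 0"
  by (simp add: quadform_columns neg_semidef_matrix_def sum_nonpos)

lemma quadform_congruence: "quadform (transpose T ** M ** T) X = quadform M (T ** X)"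
  by (simp add: quadform_def inner_matrix_mult_transpose matrix_mul_assoc[symmetric])

lemma quadform_block_diag: "quadform (M \<oplus> N) (X === Y) = quadform M X + quadform N Y"
  by (simp add: quadform_def block_diag_def vcat_mult hcat_mult_vcat inner_vcat
      matrix_mult_zero_left)

lemma quadform_minus_scaleR: "quadform (- (c *\<^sub>R M)) X = - (c * quadform M X)"
  by (simp add: quadform_def matrix_mult_minus_left matrix_mult_scaleR_left)

text \<open>Up to the factor -2 this is the product in the sector bound, so the form is nonnegative
  when \<open>Y\<close> and \<open>U\<close> are the deviations of a point and its gradient from
  those at the optimum.\<close>

lemma quadform_M0:
  "quadform (M0 m L) (Y === U) = - 2 * ((U - m *\<^sub>R Y) \<bullet> (U - L *\<^sub>R Y))"
  by (simp add: quadform_def M0_def vcat_mult hcat_mult_vcat inner_vcat mat_1x1_mult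
      inner_simps inner_commute[of U Y] algebra_simps)

text \<open>When \<open>V\<close> is the Laplacian output, \<open>Z - V\<close> is the identity
  minus the Laplacian applied to \<open>Z\<close>; summed over the agents, the form thus compares
  this image with \<open>Z\<close> in the seminorm of a positive semidefinite
  \<open>R\<close>.\<close>

lemma quadform_kronecker2_M1:
  "quadform (kronecker2 (M1 \<sigma>) R) (Z === V) = \<sigma>\<^sup>2 * quadform R Z - quadform R (Z - V)"
proof -
  have mat11: "(mat c :: real ^ 1 ^ 1) $ 1 $ 1 = c" for c by (simp add: mat_def)
  show ?thesis
    by (simp add: quadform_def kronecker2_def M1_def vcat_mult hcat_mult_vcat inner_vcat mat11
        matrix_mult_scaleR_left matrix_mult_minus_left matrix_mult_diff_left matrix_mult_diff_right inner_simps
        algebra_simps)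
qed

section \<open>Definite matrices: coercivity, sums of squares and spectral norm bounds\<close>

text \<open>The form attains a positive minimum on the compact unit sphere; homogeneity extends the
  bound to all vectors, and summation over columns to matrices.\<close>

lemma pos_def_matrix_coercive:
  assumes "pos_def_matrix M"
  shows "\<exists>\<epsilon>>0. \<forall>X. \<epsilon> * (norm X)\<^sup>2 \<le> quadform M X"
proof -
  let ?q = "\<lambda>w. w \<bullet> (M *v w)"
  have "continuous_on (sphere 0 1) ?q"
    by (intro continuous_intros linear_continuous_on matrix_vector_mul_bounded_linear)
  moreover have "sphere (0 :: real ^ 'a) 1 \<noteq> {}"
    by simp
  ultimately obtain e where e: "e \<in> sphere 0 1" and min: "\<And>w. w \<in> sphere 0 1 \<Longrightarrow> ?q e \<le> ?q w"
    using continuous_attains_inf[OF compact_sphere, of 0 1 ?q] by blast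
  have bound: "?q e * (norm w)\<^sup>2 \<le> ?q w" for w
  proof (cases "w = 0")
    case False
    let ?w = "(1 / norm w) *\<^sub>R w"
    have "?q e \<le> ?q ?w" by (rule min) (use False in simp)
    also have "?q ?w = ?q w / (norm w)\<^sup>2"
      by (simp add: matrix_vector_mult_scaleR power2_eq_square)
    finally show ?thesis using False by (simp only: pos_le_divide_eq zero_less_power zero_less_norm_iff not_False_eq_True)
  qed simp
  have "?q e * (norm X)\<^sup>2 \<le> quadform M X" for X :: "real ^ 'b ^ 'a"
    unfolding power2_norm_eq_inner inner_columns quadform_columns sum_distrib_left
    by (intro sum_mono bound[unfolded power2_norm_eq_inner])
  moreover have "e \<noteq> 0"
    using e by auto
  then have "?q e > 0"
    using assms by (simp add: pos_def_matrix_def)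
  ultimately show ?thesis by blast
qed

text \<open>Symmetric Gaussian elimination: each step splits off the square of one linear form and
  leaves a positive semidefinite remainder with fewer nonzero columns, whose number is the induction
  measure.\<close>

lemma pos_semidef_matrix_sum_squares:
  assumes "pos_semidef_matrix R"
  shows "\<exists>rs. \<forall>w. w \<bullet> (R *v w) = (\<Sum>r\<leftarrow>rs. (r \<bullet> w)\<^sup>2)"
  using assms
proof (induction "card {j. R *v axis j 1 \<noteq> 0}" arbitrary: R rule: less_induct)
  case less
  have sym: "v \<bullet> (R *v w) = (R *v v) \<bullet> w" for v w
    using less.prems by (metis dot_lmul_matrix pos_semidef_matrix_def vector_transpose_matrix)
  have psd: "w \<bullet> (R *v w) \<ge> 0" for w
    using less.prems by (simp add: pos_semidef_matrix_def)
  show ?case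
  proof (cases "\<exists>j. R *v axis j 1 \<noteq> 0")
    case False
    then have "R *v w = 0" for w
      by (simp add: matrix_vector_mult_basis) (simp add: matrix_mult_sum)
    then show ?thesis by (intro exI[of _ "[]"]) simp
  next
    case True
    then obtain j where j: "R *v axis j 1 \<noteq> 0" by blast
    define e where "e = (axis j 1 :: real ^ 'a)"
    define b where "b = R *v e"
    define a where "a = e \<bullet> b"
    have b0: "b \<noteq> 0" using j by (simp add: b_def e_def)
    \<comment> \<open>On the line through \<open>w\<close> in direction \<open>e\<close> the form is
      a quadratic polynomial in \<open>t\<close> with leading coefficient \<open>a\<close>; its
      nonnegativity is exploited twice.\<close>
    have expand: "(w + t *\<^sub>R e) \<bullet> (R *v (w + t *\<^sub>R e)) = w \<bullet> (R *v w) + 2 * t * (b \<bullet> w) + t\<^sup>2 * a" for w t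
    proof -
      have "w \<bullet> (R *v e) = b \<bullet> w" "e \<bullet> (R *v w) = b \<bullet> w"
        unfolding b_def by (rule inner_commute, rule sym)
      then show ?thesis
        by (simp add: matrix_vector_right_distrib matrix_vector_mult_scaleR inner_simps
            power2_eq_square a_def b_def algebra_simps)
    qed
    have "a > 0"
    proof (rule ccontr)
      assume "\<not> a > 0"
      moreover have "a \<ge> 0" using psd[of e] by (simp add: a_def b_def)
      ultimately have "a = 0" by simp
      \<comment> \<open>With \<open>a = 0\<close> the polynomial for \<open>w = b\<close> is affine
        in \<open>t\<close> with slope \<open>2 * (b \<bullet> b) > 0\<close>; this \<open>t\<close>
        gives it the value -1.\<close>
      define t where "t = - (b \<bullet> (R *v b) + 1) / (2 * (b \<bullet> b))"
      have "2 * t * (b \<bullet> b) = - (b \<bullet> (R *v b) + 1)"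
        using b0 by (simp add: t_def)
      moreover have "0 \<le> (b + t *\<^sub>R e) \<bullet> (R *v (b + t *\<^sub>R e))" by (rule psd)
      ultimately show False unfolding expand \<open>a = 0\<close> by simp
    qed
    \<comment> \<open>One step of symmetric elimination: \<open>R'\<close> annihilates \<open>e\<close> and everything that \<open>R\<close> does.\<close>
    define R' where "R' = R - (1 / a) *\<^sub>R (\<chi> i k. b $ i * b $ k)"
    have R'v: "R' *v w = R *v w - ((b \<bullet> w) / a) *\<^sub>R b" for w
    proof -
      have "(\<chi> i k. b $ i * b $ k) *v w = (b \<bullet> w) *\<^sub>R b"
        by (simp add: vec_eq_iff matrix_vector_mult_def inner_vec_def sum_distrib_left ac_simps)
      then show ?thesis
        by (simp add: R'_def matrix_vector_mult_diff_rdistrib scaleR_matrix_vector_assoc[symmetric])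
    qed
    have q': "w \<bullet> (R' *v w) = w \<bullet> (R *v w) - (b \<bullet> w)\<^sup>2 / a" for w
      by (simp add: R'v inner_simps inner_commute power2_eq_square)
    have "pos_semidef_matrix R'"
      unfolding pos_semidef_matrix_def
    proof (intro conjI allI)
      have "transpose R = R" using less.prems by (simp add: pos_semidef_matrix_def)
      then show "transpose R' = R'"
        by (simp add: R'_def transpose_def vec_eq_iff mult.commute)
    next
      fix w
      \<comment> \<open>The minimiser of the polynomial; the minimum is exactly the form of
        \<open>R'\<close> at \<open>w\<close>.\<close>
      define t where "t = - (b \<bullet> w) / a"
      have "2 * t * (b \<bullet> w) + t\<^sup>2 * a = - ((b \<bullet> w)\<^sup>2 / a)"
        using \<open>a > 0\<close> by (simp add: t_def power2_eq_square field_simps)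
      moreover have "0 \<le> (w + t *\<^sub>R e) \<bullet> (R *v (w + t *\<^sub>R e))" by (rule psd)
      ultimately have "0 \<le> w \<bullet> (R *v w) - (b \<bullet> w)\<^sup>2 / a"
        unfolding expand by simp
      then show "0 \<le> w \<bullet> (R' *v w)" by (simp only: q')
    qed
    moreover have "card {k. R' *v axis k 1 \<noteq> 0} < card {k. R *v axis k 1 \<noteq> 0}"
    proof (rule psubset_card_mono)
      have "R' *v axis k 1 = 0" if "R *v axis k 1 = 0" for k
      proof -
        have "b \<bullet> axis k 1 = 0" by (simp add: b_def sym[symmetric] that)
        then show ?thesis by (simp add: R'v that)
      qed
      moreover have "R' *v axis j 1 = 0"
      proof -
        have "b \<bullet> e = a" by (simp add: a_def inner_commute)
        then show ?thesis using \<open>a > 0\<close> by (simp add: R'v e_def[symmetric] b_def[symmetric])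
      qed
      ultimately show "{k. R' *v axis k 1 \<noteq> 0} \<subset> {k. R *v axis k 1 \<noteq> 0}" using j by blast
    qed simp
    ultimately obtain rs where rs: "\<And>w. w \<bullet> (R' *v w) = (\<Sum>r\<leftarrow>rs. (r \<bullet> w)\<^sup>2)"
      using less.hyps by blast
    \<comment> \<open>The square that was split off, \<open>(b \<bullet> w)^2 / a\<close>, belongs
      to the vector \<open>b / sqrt a\<close>.\<close>
    have "w \<bullet> (R *v w) = (\<Sum>r\<leftarrow>((1 / sqrt a) *\<^sub>R b) # rs. (r \<bullet> w)\<^sup>2)" for w
      using q'[of w] \<open>a > 0\<close> by (simp add: rs[symmetric] power_divide)
    then show ?thesis by blast
  qed
qed

text \<open>For one linear form \<open>r\<close> the numbers \<open>r \<bullet> z i\<close> are the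
  entries of a vector indexed by the agents, to which the bound on \<open>W\<close> applies.
  \<open>R\<close> is a sum of squares of such forms, and the matrices \<open>Z i\<close> are
  treated column by column.\<close>

lemma sum_quadform_onorm_le:
  fixes W :: "real ^ 'n ^ 'n" and Z :: "'n \<Rightarrow> real ^ 'd ^ 'c"
  assumes R: "pos_semidef_matrix R" and W: "onorm ((*v) W) \<le> \<sigma>"
  shows "(\<Sum>i\<in>UNIV. quadform R (\<Sum>j\<in>UNIV. W $ i $ j *\<^sub>R Z j)) \<le> \<sigma>\<^sup>2 * (\<Sum>i\<in>UNIV. quadform R (Z i))"
proof -
  obtain rs where rs: "\<And>w. w \<bullet> (R *v w) = (\<Sum>r\<leftarrow>rs. (r \<bullet> w)\<^sup>2)"
    using pos_semidef_matrix_sum_squares[OF R] by blast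
  have scalar: "(\<Sum>i\<in>UNIV. ((W *v w) $ i)\<^sup>2) \<le> \<sigma>\<^sup>2 * (\<Sum>i\<in>UNIV. (w $ i)\<^sup>2)" for w
  proof -
    have "norm (W *v w) \<le> \<sigma> * norm w"
      using norm_matrix_mult_le[of W w] mult_right_mono[OF W norm_ge_zero[of w]] by linarith
    then have "(norm (W *v w))\<^sup>2 \<le> (\<sigma> * norm w)\<^sup>2"
      by (intro power_mono) simp_all
    then show ?thesis
      unfolding power_mult_distrib power2_norm_eq_inner
      by (simp add: inner_vec_def power2_eq_square)
  qed
  have vec: "(\<Sum>i\<in>UNIV. let w = (\<Sum>j\<in>UNIV. W $ i $ j *\<^sub>R z j) in w \<bullet> (R *v w))
      \<le> \<sigma>\<^sup>2 * (\<Sum>i\<in>UNIV. z i \<bullet> (R *v z i))" for z :: "'n \<Rightarrow> real ^ 'c"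
  proof -
    have "(\<Sum>i\<in>UNIV. (r \<bullet> (\<Sum>j\<in>UNIV. W $ i $ j *\<^sub>R z j))\<^sup>2) \<le> \<sigma>\<^sup>2 * (\<Sum>i\<in>UNIV. (r \<bullet> z i)\<^sup>2)" for r
      using scalar[of "\<chi> i. r \<bullet> z i"] by (simp add: matrix_vector_mult_def inner_sum_right)
    then show ?thesis
      unfolding rs Let_def
      by (induction rs) (simp_all add: sum.distrib distrib_left add_mono)
  qed
  have col: "column l (\<Sum>j\<in>UNIV. W $ i $ j *\<^sub>R Z j) = (\<Sum>j\<in>UNIV. W $ i $ j *\<^sub>R column l (Z j))" for i l
    by (simp add: vec_eq_iff column_def)
  have "(\<Sum>l\<in>UNIV. \<Sum>i\<in>UNIV. let w = (\<Sum>j\<in>UNIV. W $ i $ j *\<^sub>R column l (Z j)) in w \<bullet> (R *v w))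
      \<le> (\<Sum>l\<in>UNIV. \<sigma>\<^sup>2 * (\<Sum>i\<in>UNIV. column l (Z i) \<bullet> (R *v column l (Z i))))"
    by (intro sum_mono vec)
  then show ?thesis
    unfolding quadform_columns col Let_def sum_distrib_left[symmetric]
    by (simp add: sum.swap[of _ "UNIV :: 'd set" "UNIV :: 'n set"])
qed


section \<open>Averages over the agents and deviations from them\<close>

definition mean :: "('n::finite \<Rightarrow> 'a::real_vector) \<Rightarrow> 'a"
  where "mean X = (1 / real CARD('n)) *\<^sub>R (\<Sum>i\<in>UNIV. X i)"

lemma sum_eq_mean: "(\<Sum>i\<in>UNIV. X i) = real CARD('n) *\<^sub>R mean X" for X :: "'n::finite \<Rightarrow> 'a::real_vector"
  by (simp add: mean_def)

lemma mean_add: "mean (\<lambda>i. X i + Y i) = mean X + mean Y"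
  by (simp add: mean_def sum.distrib scaleR_add_right)

lemma mean_matrix_mult: "mean (\<lambda>i. M ** X i) = M ** mean X" for M :: "real ^ 'a ^ 'b"
  by (simp add: mean_def matrix_mult_scaleR_right matrix_mult_sum_right)

lemma mean_output:
  fixes M :: "real ^ 'a ^ 'b" and N :: "real ^ 'e ^ 'b" and K :: "real ^ 'g ^ 'b"
  assumes "\<And>i. G i = M ** X i + (N ** U i + K ** V i)" and "mean V = 0"
  shows "mean G = M ** mean X + N ** mean U"
proof -
  have "mean G = mean (\<lambda>i. M ** X i + (N ** U i + K ** V i))"
    by (simp add: assms(1) mean_def)
  then show ?thesis
    by (simp add: mean_add mean_matrix_mult assms(2) matrix_mult_zero_right)
qed

lemma mean_vcat: "mean (\<lambda>i. X i === Y i) = (mean X === mean Y)"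
  by (simp add: vec_sum_eq_iff mean_def)

lemma vcat_diff: "(A === B) - (C === D) = (A - C === B - D)"
  by (simp add: vec_sum_eq_iff)

lemma sum_diff_mean: "(\<Sum>i\<in>UNIV. X i - mean X) = 0" for X :: "'n::finite \<Rightarrow> 'a::real_vector"
  by (simp add: sum_subtractf sum_eq_mean sum_constant_scaleR del: sum_constant)

text \<open>The analogue of splitting a second moment into squared mean and variance: both cross
  terms are linear in the deviations, which sum to zero.\<close>

lemma sum_quadform_mean:
  fixes X :: "'n::finite \<Rightarrow> real ^ 'b ^ 'a"
  shows "(\<Sum>i\<in>UNIV. quadform M (X i))
    = real CARD('n) * quadform M (mean X) + (\<Sum>i\<in>UNIV. quadform M (X i - mean X))"
proof -
  let ?\<mu> = "mean X"
  have split: "quadform M (X i)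
      = quadform M ?\<mu> + ?\<mu> \<bullet> (M ** (X i - ?\<mu>)) + (X i - ?\<mu>) \<bullet> (M ** ?\<mu>) + quadform M (X i - ?\<mu>)" for i
    by (simp add: quadform_def matrix_mult_diff_right inner_simps)
  have "(\<Sum>i\<in>UNIV. ?\<mu> \<bullet> (M ** (X i - ?\<mu>))) = 0"
    by (simp add: inner_sum_right[symmetric] matrix_mult_sum_right[symmetric] sum_diff_mean
        matrix_mult_zero_right)
  moreover have "(\<Sum>i\<in>UNIV. (X i - ?\<mu>) \<bullet> (M ** ?\<mu>)) = 0"
    by (simp add: inner_sum_left[symmetric] sum_diff_mean)
  ultimately show ?thesis
    by (subst split) (simp add: sum.distrib)
qed

section \<open>Column spaces and bases of null spaces\<close>

lemma span_columns_iff: "w \<in> span (columns M) \<longleftrightarrow> (\<exists>h. w = M *v h)" for M :: "real ^ 'a ^ 'b"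
proof
  have "subspace (range ((*v) M))"
    by (intro linear_subspace_image matrix_vector_mul_linear subspace_UNIV)
  moreover have "columns M \<subseteq> range ((*v) M)"
    by (auto simp: columns_image_basis)
  ultimately have "span (columns M) \<subseteq> range ((*v) M)"
    by (rule span_minimal[rotated])
  then show "w \<in> span (columns M) \<Longrightarrow> \<exists>h. w = M *v h" by auto
qed (auto intro: matrix_vector_mult_in_columnspace)

text \<open>Every column of \<open>X\<close> lies in the null space, hence in the span of the
  columns of \<Psi>. This makes a matrix inequality compressed by \<Psi> applicable to
  \<open>X\<close>.\<close>

lemma null_space_basis_factor:
  fixes M :: "real ^ 'a ^ 'b" and X :: "real ^ 'd ^ 'a" and \<Psi> :: "real ^ 's ^ 'a"
  assumes "columns_form_basis \<Psi> (null_space M)" and "M ** X = 0"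
  shows "\<exists>Y. X = \<Psi> ** Y"
proof -
  have "column j X \<in> span (columns \<Psi>)" for j
  proof -
    have "M *v column j X = column j (M ** X)" by (simp add: column_matrix_mult)
    then have "M *v column j X = 0" by (simp add: assms(2) column_def vec_eq_iff)
    with assms(1) show ?thesis by (simp add: columns_form_basis_def null_space_def)
  qed
  then obtain h where h: "\<And>j. column j X = \<Psi> *v h j"
    unfolding span_columns_iff by metis
  have "X = \<Psi> ** (\<chi> k j. h j $ k)"
    using h by (simp add: vec_eq_iff column_def matrix_matrix_mult_def matrix_vector_mult_def)
  then show ?thesis ..
qed

section \<open>Laplacians of balanced graphs\<close>

lemma sum_Laplacian_balanced:
  fixes W :: "real ^ 'n ^ 'n" and Z :: "'n \<Rightarrow> 'a::real_vector"
  assumes "1 v* W = 0"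
  shows "(\<Sum>i\<in>UNIV. \<Sum>j\<in>UNIV. W $ i $ j *\<^sub>R Z j) = 0"
proof -
  have "(\<Sum>i\<in>UNIV. W $ i $ j) = 0" for j
    using assms by (simp add: vec_eq_iff vector_matrix_mult_def)
  then show ?thesis
    by (subst sum.swap) (simp add: scaleR_sum_left[symmetric])
qed

lemma Laplacian_const:
  fixes W :: "real ^ 'n ^ 'n" and c :: "'a::real_vector"
  assumes "W *v 1 = 0"
  shows "(\<Sum>j\<in>UNIV. W $ i $ j *\<^sub>R c) = 0"
  using assms by (simp add: vec_eq_iff matrix_vector_mult_def scaleR_sum_left[symmetric])

text \<open>On families with sum zero the averaging matrix vanishes, so the matrix bounded in
  \<open>W\<close> maps \<open>Z\<close> to the differences of \<open>Z\<close> and its Laplacian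
  output, and the form of \<open>M1\<close> is the slack in the resulting contraction.\<close>

lemma Laplacian_quadform_nonneg:
  fixes W :: "real ^ 'n ^ 'n" and Z :: "'n \<Rightarrow> real ^ 'd ^ 'c"
  assumes R: "pos_semidef_matrix R"
    and W: "onorm ((*v) (mat 1 - averaging_matrix - W)) \<le> \<sigma>"
    and Z: "(\<Sum>i\<in>UNIV. Z i) = 0"
  shows "0 \<le> (\<Sum>i\<in>UNIV. quadform (kronecker2 (M1 \<sigma>) R) (Z i === (\<Sum>j\<in>UNIV. W $ i $ j *\<^sub>R Z j)))"
proof -
  have "(\<Sum>j\<in>UNIV. (mat 1 - averaging_matrix - W) $ i $ j *\<^sub>R Z j) = Z i - (\<Sum>j\<in>UNIV. W $ i $ j *\<^sub>R Z j)" for i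
  proof -
    have "(\<Sum>j\<in>UNIV. (mat 1 :: real ^ 'n ^ 'n) $ i $ j *\<^sub>R Z j) = Z i"
      by (simp add: mat_def if_distrib[of "\<lambda>a. a *\<^sub>R _"] cong: if_cong)
    moreover have "(\<Sum>j\<in>UNIV. (averaging_matrix :: real ^ 'n ^ 'n) $ i $ j *\<^sub>R Z j) = 0"
      by (simp add: averaging_matrix_def scaleR_sum_right[symmetric] Z)
    ultimately show ?thesis by (simp add: scaleR_left_diff_distrib sum_subtractf)
  qed
  then show ?thesis
    using sum_quadform_onorm_le[OF R W, of Z]
    by (simp add: quadform_kronecker2_M1 sum_subtractf sum_distrib_left)
qed

section \<open>The two matrix inequalities as dissipation inequalities\<close>

text \<open>The stack of \<open>X\<close> and \<open>U\<close> lies in the null space of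
  \<open>Fx ||| Fu\<close>, so it equals \<open>\<Psi> ** Y\<close> for some \<open>Y\<close>, and
  the matrix inequality is evaluated at this \<open>Y\<close>.\<close>

lemma consensus_lmi_quadform:
  fixes A P :: "real ^ 'p ^ 'p" and Cy :: "real ^ 'p ^ 1" and Dyu :: "real ^ 1 ^ 1"
    and Bu :: "real ^ 1 ^ 'p" and Fx :: "real ^ 'p ^ 'r" and X :: "real ^ 'd ^ 'p" and N :: "real ^ (1 + 1) ^ (1 + 1)"
  defines "T \<equiv> ((A ||| Bu) === (mat 1 ||| 0) === (Cy ||| Dyu) === (0 ||| mat 1))"
  assumes "columns_form_basis \<Psi> (null_space (Fx ||| Fu))"
    and "neg_semidef_matrix (transpose \<Psi> ** transpose T ** (P \<oplus> - (c *\<^sub>R P) \<oplus> N) ** T ** \<Psi>)"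
    and "Fx ** X + Fu ** U = 0"
  shows "quadform P (A ** X + Bu ** U) + quadform N (Cy ** X + Dyu ** U === U) \<le> c * quadform P X"
proof -
  obtain Y where Y: "(X === U) = \<Psi> ** Y"
    using null_space_basis_factor[OF assms(2)] assms(4) by (metis hcat_mult_vcat)
  let ?N = "P \<oplus> - (c *\<^sub>R P) \<oplus> N"
  have "quadform ?N (T ** (X === U)) = quadform (transpose (T ** \<Psi>) ** ?N ** (T ** \<Psi>)) Y"
    by (subst quadform_congruence) (simp only: Y matrix_mul_assoc)
  also have "\<dots> = quadform (transpose \<Psi> ** transpose T ** ?N ** T ** \<Psi>) Y"
    by (simp only: matrix_transpose_mul matrix_mul_assoc)
  also have "\<dots> \<le> 0"
    by (rule quadform_neg_semidef[OF assms(3)])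
  finally show ?thesis
    by (simp add: T_def vcat_mult hcat_mult_vcat quadform_block_diag quadform_minus_scaleR
        matrix_mult_zero_left)
qed

text \<open>From state, input and communication, \<open>T\<close> produces the next state, the
  state, the sector pair \<open>(y, u)\<close> and the communication pair \<open>(z, v)\<close>,
  matching the four diagonal blocks.\<close>

lemma disagreement_lmi_quadform:
  fixes A Q :: "real ^ 'p ^ 'p" and Cy :: "real ^ 'p ^ 1" and Cz :: "real ^ 'p ^ 'c"
    and Bu :: "real ^ 1 ^ 'p" and Bv :: "real ^ 'c ^ 'p" and Dyu :: "real ^ 1 ^ 1"
    and Dyv :: "real ^ 'c ^ 1" and Dzu :: "real ^ 1 ^ 'c" and Dzv :: "real ^ 'c ^ 'c"
    and X :: "real ^ 'd ^ 'p" and N :: "real ^ (1 + 1) ^ (1 + 1)" and K :: "real ^ ('c + 'c) ^ ('c + 'c)"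
  defines "T \<equiv> ((A ||| Bu ||| Bv) === (mat 1 ||| 0 ||| 0) ===
    ((Cy ||| Dyu ||| Dyv) === (0 ||| mat 1 ||| 0)) ===
    (Cz ||| Dzu ||| Dzv) === (0 ||| 0 ||| mat 1))"
  assumes "neg_semidef_matrix (transpose T ** (Q \<oplus> - (c *\<^sub>R Q) \<oplus> N \<oplus> K) ** T)"
  shows "quadform Q (A ** X + (Bu ** U + Bv ** V))
    + quadform N (Cy ** X + (Dyu ** U + Dyv ** V) === U)
    + quadform K (Cz ** X + (Dzu ** U + Dzv ** V) === V) \<le> c * quadform Q X"
  using quadform_neg_semidef[OF assms(2), of "X === U === V"]
  by (simp add: quadform_congruence T_def vcat_mult hcat_mult_vcat quadform_block_diag
      quadform_minus_scaleR matrix_mult_zero_left)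

section \<open>Construction of fixed points\<close>

text \<open>\<open>Cy\<close> has a single row, so a nonzero vector of its row space is a multiple
  of that row and has nonzero product with it; dividing by this product gives \<open>w\<close>.
  Moving the state along \<open>w\<close> realises any common output without input.\<close>

lemma fixed_point_direction:
  assumes "null_space (A - mat 1) \<inter> row_space Cy \<inter> null_space Fx \<noteq> {0}"
  shows "\<exists>w :: real ^ 1 ^ 'p. A ** w = w \<and> Cy ** w = mat 1 \<and> Fx ** w = 0"
proof -
  have "0 \<in> null_space (A - mat 1) \<inter> row_space Cy \<inter> null_space Fx"
    by (simp add: null_space_def row_space_def span_zero)
  with assms obtain w where w: "w \<noteq> 0" "A *v w = w" "w \<in> row_space Cy" "Fx *v w = 0"
    by (auto simp: null_space_def matrix_vector_mult_diff_rdistrib)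
  have "rows Cy = {Cy $ 1}"
    by (auto simp: rows_def row_def)
  with w(3) obtain t where t: "w = t *\<^sub>R (Cy $ 1)"
    by (auto simp: row_space_def span_singleton)
  define s where "s = (Cy $ 1) \<bullet> w"
  have "s \<noteq> 0" using w(1) by (auto simp: s_def t)
  define w' :: "real ^ 1 ^ 'p" where "w' = (\<chi> i j. w $ i / s)"
  have col: "column 1 (M ** w') = (1 / s) *\<^sub>R (M *v w)" for M :: "real ^ 'p ^ 'q"
    by (simp add: w'_def matrix_matrix_mult_def column_def matrix_vector_mult_def vec_eq_iff
        sum_divide_distrib)
  have eqI: "X = Y" if "column 1 X = column 1 Y" for X Y :: "real ^ 1 ^ 'q"
    using that by (simp add: vec_eq_iff column_def)
  have "A ** w' = w'"
    by (rule eqI) (simp add: col w(2), simp add: w'_def column_def vec_eq_iff)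
  moreover have "Fx ** w' = 0"
    by (rule eqI) (simp add: col w(4), simp add: column_def vec_eq_iff)
  moreover have "Cy ** w' = mat 1"
    by (rule eqI, subst col) (use \<open>s \<noteq> 0\<close> in \<open>simp add: vec_eq_iff column_def mat_def matrix_vector_mul_component s_def\<close>)
  ultimately show ?thesis by blast
qed

text \<open>\<open>h\<close> holds the coefficients of the column-space condition. With a constant
  input \<open>u\<close>, the state \<open>- h ** u\<close> is stationary and both outputs
  vanish.\<close>

lemma fixed_point_correction:
  assumes "column 1 (Bu === Dyu === Dzu) \<in> col_space ((A - mat 1) === Cy === Cz)"
  shows "\<exists>h :: real ^ 1 ^ 'p. A ** h = h + Bu \<and> Cy ** h = Dyu \<and> Cz ** h = Dzu"
proof -
  obtain h where h: "column 1 (Bu === Dyu === Dzu) = ((A - mat 1) === Cy === Cz) *v h"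
    using assms by (auto simp: col_space_def span_columns_iff)
  define h' :: "real ^ 1 ^ 'p" where "h' = (\<chi> i j. h $ i)"
  have "column 1 h' = h" by (simp add: h'_def column_def vec_eq_iff)
  with h have "column 1 (Bu === Dyu === Dzu) = column 1 (((A - mat 1) === Cy === Cz) ** h')"
    by (simp add: column_matrix_mult)
  then have "(Bu === Dyu === Dzu) = ((A - mat 1) === Cy === Cz) ** h'"
    by (simp add: vec_eq_iff[where ?'b='p] vec_eq_iff column_def)
  then have "A ** h' - h' = Bu \<and> Cy ** h' = Dyu \<and> Cz ** h' = Dzu"
    by (auto simp: vcat_mult vcat_eq_iff matrix_mult_diff_left)
  then show ?thesis by (metis diff_add_cancel add.commute)
qed


text \<open>The \<open>w\<close> part sets the common output and the \<open>h\<close> part absorbs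
  the inputs, so these may differ between agents while \<open>y\<close> and \<open>z\<close> agree.
  The coupling constraint holds as \<open>Fx ** w = 0\<close> and the inputs sum to zero.\<close>

lemma algorithm_equations_constant:
  fixes A :: "real ^ 'p ^ 'p" and Cz :: "real ^ 'p ^ 'c" and y :: "real ^ 'd ^ 1"
    and us :: "'n::finite \<Rightarrow> real ^ 'd ^ 1"
  assumes w: "A ** w = w" "Cy ** w = mat 1" "Fx ** w = 0"
    and h: "A ** h = h + Bu" "Cy ** h = Dyu" "Cz ** h = Dzu"
    and Lap: "\<And>k. Lap k *v 1 = 0" and us: "(\<Sum>i\<in>UNIV. us i) = 0"
  shows "algorithm_equations ((A ||| Bu ||| Bv) === (Cy ||| Dyu ||| Dyv) === (Cz ||| Dzu ||| Dzv))
    Fx Fu Lap (\<lambda>_ i. w ** y - h ** us i) (\<lambda>_ _. y) (\<lambda>_ _. Cz ** w ** y) (\<lambda>_. us) (\<lambda>_ _. 0)"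
proof -
  have "Fx ** (w ** y - h ** us i) = - (Fx ** h ** us i)" for i
    by (simp add: matrix_mult_diff_right matrix_mul_assoc w matrix_mult_zero_left)
  then have "(\<Sum>i\<in>UNIV. Fx ** (w ** y - h ** us i) + Fu ** us i) = 0"
    by (simp add: sum_subtractf matrix_mult_sum_right[symmetric] us matrix_mult_zero_right)
  moreover have "A ** (w ** y - h ** us i) + Bu ** us i = w ** y - h ** us i" for i
    by (simp add: matrix_mult_diff_right matrix_mul_assoc w h matrix_mult_add_left)
  moreover have "Cy ** (w ** y - h ** us i) + Dyu ** us i = y" for i
    by (simp add: matrix_mult_diff_right matrix_mul_assoc w h)
  moreover have "Cz ** (w ** y - h ** us i) + Dzu ** us i = Cz ** w ** y" for i
    by (simp add: matrix_mult_diff_right matrix_mul_assoc h)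
  ultimately show ?thesis
    by (simp add: algorithm_equations_def vcat_mult hcat_mult_vcat vcat_eq_iff
        matrix_mult_zero_right Laplacian_const[OF Lap])
qed

section \<open>The Lyapunov function and its decay\<close>

text \<open>The factor \<open>CARD('n)\<close> is the weight of the average in
  \<open>sum_quadform_mean\<close>; with it the sector terms of average and disagreement recombine
  into those of the agents.\<close>

definition lyapunov :: "real ^ 'p ^ 'p \<Rightarrow> real ^ 'p ^ 'p \<Rightarrow> ('n::finite \<Rightarrow> real ^ 'd ^ 'p) \<Rightarrow> real"
  where "lyapunov P Q X =
    real CARD('n) * quadform P (mean X) + (\<Sum>i\<in>UNIV. quadform Q (X i - mean X))"

lemma lyapunov_coercive:
  assumes "pos_def_matrix P" and "pos_def_matrix Q"
  shows "\<exists>\<delta>>0. \<forall>(X :: 'n::finite \<Rightarrow> real ^ 'd ^ 'p) i. \<delta> * (norm (X i))\<^sup>2 \<le> lyapunov P Q X"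
proof -
  obtain \<alpha> where \<alpha>: "\<alpha> > 0" "\<And>X :: real ^ 'd ^ 'p. \<alpha> * (norm X)\<^sup>2 \<le> quadform P X"
    using pos_def_matrix_coercive[OF assms(1)] by metis
  obtain \<beta> where \<beta>: "\<beta> > 0" "\<And>X :: real ^ 'd ^ 'p. \<beta> * (norm X)\<^sup>2 \<le> quadform Q X"
    using pos_def_matrix_coercive[OF assms(2)] by metis
  have nonneg: "0 \<le> quadform P X" "0 \<le> quadform Q X" for X :: "real ^ 'd ^ 'p"
    using \<alpha>(1) \<beta>(1) by (auto intro: order_trans[OF _ \<alpha>(2)] order_trans[OF _ \<beta>(2)])
  \<comment> \<open>The factor 1/2 compensates \<open>(a + b)^2 \<le> 2 * (a^2 + b^2)\<close>, where
    \<open>a\<close> and \<open>b\<close> are the norms of average and disagreement.\<close>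
  define \<delta> where "\<delta> = min \<alpha> \<beta> / 2"
  have "\<delta> * (norm (X i))\<^sup>2 \<le> lyapunov P Q X" for X :: "'n \<Rightarrow> real ^ 'd ^ 'p" and i
  proof -
    let ?a = "norm (mean X)" and ?b = "norm (X i - mean X)"
    have "norm (X i) \<le> ?a + ?b"
      by (rule norm_triangle_sub)
    then have "(norm (X i))\<^sup>2 \<le> (?a + ?b)\<^sup>2"
      by (intro power_mono) simp_all
    also have "\<dots> \<le> 2 * (?a\<^sup>2 + ?b\<^sup>2)"
      using sum_squares_bound[of ?a ?b] by (simp add: power2_sum)
    finally have "\<delta> * (norm (X i))\<^sup>2 \<le> min \<alpha> \<beta> * ?a\<^sup>2 + min \<alpha> \<beta> * ?b\<^sup>2"
      using mult_left_mono[of _ _ \<delta>] \<alpha>(1) \<beta>(1) by (fastforce simp: \<delta>_def algebra_simps)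
    also have "\<dots> \<le> \<alpha> * ?a\<^sup>2 + \<beta> * ?b\<^sup>2"
      by (intro add_mono mult_right_mono) simp_all
    also have "\<dots> \<le> quadform P (mean X) + quadform Q (X i - mean X)"
      by (intro add_mono \<alpha> \<beta>)
    also have "\<dots> \<le> lyapunov P Q X"
      unfolding lyapunov_def
    proof (rule add_mono)
      have "1 \<le> real CARD('n)" by (simp add: Suc_le_eq)
      from mult_right_mono[OF this nonneg(1)]
      show "quadform P (mean X) \<le> real CARD('n) * quadform P (mean X)" by simp
      show "quadform Q (X i - mean X) \<le> (\<Sum>i\<in>UNIV. quadform Q (X i - mean X))"
        by (rule member_le_sum) (simp_all add: nonneg)
    qed
    finally show ?thesis .
  qed
  moreover have "\<delta> > 0" using \<alpha>(1) \<beta>(1) by (simp add: \<delta>_def)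
  ultimately show ?thesis by blast
qed

lemma lyapunov_decrease:
  fixes X X' :: "'n::finite \<Rightarrow> real ^ 'd ^ 'p"
  assumes "quadform P (mean X') + quadform N (mean Y === mean U) \<le> c * quadform P (mean X)"
    and "\<And>i. quadform Q (X' i - mean X') + quadform N (Y i - mean Y === U i - mean U)
      + quadform K (Z i - mean Z === V i) \<le> c * quadform Q (X i - mean X)"
    and "\<And>i. 0 \<le> quadform N (Y i === U i)"
    and "0 \<le> (\<Sum>i\<in>UNIV. quadform K (Z i - mean Z === V i))"
  shows "lyapunov P Q X' \<le> c * lyapunov P Q X"
proof -
  have "real CARD('n) * (quadform P (mean X') + quadform N (mean Y === mean U))
      \<le> real CARD('n) * (c * quadform P (mean X))"
    by (intro mult_left_mono assms(1)) simp
  moreover have "(\<Sum>i\<in>UNIV. quadform Q (X' i - mean X') + quadform N (Y i - mean Y === U i - mean U)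
      + quadform K (Z i - mean Z === V i)) \<le> (\<Sum>i\<in>UNIV. c * quadform Q (X i - mean X))"
    by (intro sum_mono assms(2))
  moreover have "0 \<le> (\<Sum>i\<in>UNIV. quadform N (Y i === U i))"
    by (intro sum_nonneg assms(3))
  then have "0 \<le> real CARD('n) * quadform N (mean Y === mean U)
      + (\<Sum>i\<in>UNIV. quadform N (Y i - mean Y === U i - mean U))"
    by (simp add: sum_quadform_mean[of N "\<lambda>i. Y i === U i"] mean_vcat vcat_diff)
  ultimately show ?thesis
    using assms(4) by (simp add: lyapunov_def sum.distrib sum_distrib_left algebra_simps)
qed

lemma geometric_decay:
  fixes V :: "nat \<Rightarrow> real"
  assumes "\<And>k. V (Suc k) \<le> \<rho>\<^sup>2 * V k"
  shows "V k \<le> (\<rho> ^ k)\<^sup>2 * V 0"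
proof (induction k)
  case (Suc k)
  have "V (Suc k) \<le> \<rho>\<^sup>2 * V k" by (rule assms)
  also have "\<dots> \<le> \<rho>\<^sup>2 * ((\<rho> ^ k)\<^sup>2 * V 0)" by (intro mult_left_mono Suc) simp
  finally show ?case by (simp add: power_mult_distrib mult.assoc)
qed simp

lemma sector_quadform_nonneg:
  assumes "function_assumption m L f yopt"
  shows "0 \<le> quadform (M0 m L)
    (y - row_vec yopt === grad_row (f i) y - row_vec (grad (f i) yopt))"
proof -
  have inner1: "a \<bullet> b = a $ 1 \<bullet> b $ 1" for a b :: "real ^ 'd ^ 1"
    by (simp add: inner_vec_def[of a b])
  show ?thesis
    using assms by (simp add: quadform_M0 inner1 function_assumption_def grad_row_def row_vec_def)
qed

section \<open>Convergence: robustness, the fixed point at the optimum, deviations from it and their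
  rate\<close>

theorem theorem10:
  fixes A :: "real ^ 'p ^ 'p" and Bu :: "real ^ 1 ^ 'p" and Bv :: "real ^ 'c ^ 'p"
    and Cy :: "real ^ 'p ^ 1" and Dyu :: "real ^ 1 ^ 1" and Dyv :: "real ^ 'c ^ 1"
    and Cz :: "real ^ 'p ^ 'c" and Dzu :: "real ^ 1 ^ 'c" and Dzv :: "real ^ 'c ^ 'c"
    and Fx :: "real ^ 'p ^ 'r" and Fu :: "real ^ 1 ^ 'r"
    and f :: "'n::finite \<Rightarrow> real ^ 'd \<Rightarrow> real" and yopt :: "real ^ 'd"
    and E :: "nat \<Rightarrow> ('n \<times> 'n) set" and Lap :: "nat \<Rightarrow> real ^ 'n ^ 'n"
    and m L \<sigma> \<rho> :: real
    and \<Psi> :: "real ^ 's ^ ('p + 1)"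
    and P Q :: "real ^ 'p ^ 'p" and R :: "real ^ 'c ^ 'c"
    and x :: "nat \<Rightarrow> 'n \<Rightarrow> real ^ 'd ^ 'p"
    and y u :: "nat \<Rightarrow> 'n \<Rightarrow> real ^ 'd ^ 1"
    and z v :: "nat \<Rightarrow> 'n \<Rightarrow> real ^ 'd ^ 'c"
  defines "S \<equiv> ((A  ||| Bu  ||| Bv) ===
                (Cy ||| Dyu ||| Dyv) ===
                (Cz ||| Dzu ||| Dzv))"
    and "T1 \<equiv> ((A     ||| Bu)  ===
               (mat 1 ||| 0)   ===
               (Cy    ||| Dyu) ===
               (0     ||| mat 1))"
    and "T2 \<equiv> ((A     ||| Bu    ||| Bv)  ===
               (mat 1 ||| 0     ||| 0)   ===
              ((Cy    ||| Dyu   ||| Dyv) ===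
               (0     ||| mat 1 ||| 0))  ===
               (Cz    ||| Dzu   ||| Dzv) ===
               (0     ||| 0     ||| mat 1))"
  assumes local_functions: "function_assumption m L f yopt"
    and laplacians: "graph_assumption \<sigma> E Lap"
    and fixed_point_1: "null_space (A - mat 1) \<inter> row_space Cy \<inter> null_space Fx \<noteq> {0}"
    and fixed_point_2:
      "column 1 (Bu === Dyu === Dzu) \<in> col_space ((A - mat 1) === Cy === Cz)"
    and basis: "columns_form_basis \<Psi> (null_space (Fx ||| Fu))"
    and rate: "0 \<le> \<rho>"
    and P: "pos_def_matrix P" and Q: "pos_def_matrix Q" and R: "pos_semidef_matrix R"
    and lmi_1: "neg_semidef_matrix (transpose \<Psi> ** transpose T1 **
      (P \<oplus> - (\<rho>\<^sup>2 *\<^sub>R P) \<oplus> M0 m L) ** T1 ** \<Psi>)"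
    and lmi_2: "neg_semidef_matrix (transpose T2 **
      (Q \<oplus> - (\<rho>\<^sup>2 *\<^sub>R Q) \<oplus> M0 m L \<oplus> kronecker2 (M1 \<sigma>) R) ** T2)"
    and traj: "trajectory S Fx Fu f Lap x y z u v"
  shows "\<exists>c0 > 0. \<exists>xs ys zs us vs.
    fixed_point S Fx Fu f Lap xs ys zs us vs \<and>
    consensus_optimal ys us \<and> robust_to_graph zs vs \<and>
    robust_to_functions TYPE('d) S Fx Fu Lap \<and>
    (\<forall>i. ys i = row_vec yopt) \<and> (\<forall>i. us i = row_vec (grad (f i) yopt)) \<and>
    (\<forall>i k. norm (x k i - xs i) \<le> c0 * \<rho> ^ k)"
proof -
  have Lap1: "Lap k *v 1 = 0" and bal: "1 v* Lap k = 0"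
    and W: "onorm ((*v) (mat 1 - averaging_matrix - Lap k)) \<le> \<sigma>" for k
    using laplacians by (auto simp: graph_assumption_def)
  obtain w :: "real ^ 1 ^ 'p" where w: "A ** w = w" "Cy ** w = mat 1" "Fx ** w = 0"
    using fixed_point_direction[OF fixed_point_1] by blast
  obtain h :: "real ^ 1 ^ 'p" where h: "A ** h = h + Bu" "Cy ** h = Dyu" "Cz ** h = Dzu"
    using fixed_point_correction[OF fixed_point_2] by blast
  note const = algorithm_equations_constant[OF w h Lap1, where Bv = Bv and Dyv = Dyv and Dzv = Dzv,
      folded S_def]

  have robust: "robust_to_functions TYPE('d) S Fx Fu Lap"
    unfolding robust_to_functions_def
  proof (intro allI impI)
    fix s :: "real ^ 'd ^ 1" and \<delta> :: "'n \<Rightarrow> real ^ 'd ^ 1"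
    assume \<delta>: "(\<Sum>i\<in>UNIV. \<delta> i) = 0"
    \<comment> \<open>The common output whose sum over the agents is \<open>s\<close>; \<delta>
      itself serves as the inputs, its average being zero.\<close>
    let ?y = "(1 / real CARD('n)) *\<^sub>R s"
    have "(\<Sum>i\<in>(UNIV :: 'n set). ?y) = s"
      by (simp add: sum_constant_scaleR del: sum_constant)
    with const[OF \<delta>, where Fu = Fu and y = ?y] \<delta>
    show "\<exists>xs ys zs us vs. algorithm_equations S Fx Fu Lap (\<lambda>_. xs) (\<lambda>_. ys) (\<lambda>_. zs) (\<lambda>_. us) (\<lambda>_. vs) \<and>
        consensus_optimal ys us \<and> robust_to_graph zs vs \<and> (\<Sum>i\<in>UNIV. ys i) = s \<and>
        (\<forall>i. us i - (1 / real CARD('n)) *\<^sub>R (\<Sum>j\<in>UNIV. us j) = \<delta> i)"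
      by (intro exI[of _ "\<lambda>i. w ** ?y - h ** \<delta> i"] exI[of _ "\<lambda>_. ?y"] exI[of _ "\<lambda>_. Cz ** w ** ?y"]
          exI[of _ \<delta>] exI[of _ "\<lambda>_. 0"])
        (simp add: consensus_optimal_def robust_to_graph_def)
  qed

  \<comment> \<open>The fixed point at the optimum: the inputs are the gradients at
    \<open>yopt\<close>, which sum to zero by the function assumption.\<close>
  define us where "us i = row_vec (grad (f i) yopt)" for i
  define ys where "ys = row_vec yopt"
  define xs where "xs i = w ** ys - h ** us i" for i
  define zs where "zs = Cz ** w ** ys"
  have us0: "(\<Sum>i\<in>UNIV. us i) = 0"
    using local_functions by (simp add: function_assumption_def us_def vec_eq_iff row_vec_def)
  have eqs_star: "algorithm_equations S Fx Fu Lap (\<lambda>_. xs) (\<lambda>_ _. ys) (\<lambda>_ _. zs) (\<lambda>_. us) (\<lambda>_ _. 0)"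
    using const[OF us0, where Fu = Fu and y = ys] by (simp add: xs_def[abs_def] zs_def)
  then have fp: "fixed_point S Fx Fu f Lap xs (\<lambda>_. ys) (\<lambda>_. zs) us (\<lambda>_. 0)"
    by (simp add: fixed_point_def trajectory_def us_def ys_def grad_row_def row_vec_def)

  \<comment> \<open>Deviations from this fixed point; \<open>v\<close> is its own deviation, since
    its value there is zero.\<close>
  define X where "X k i = x k i - xs i" for k i
  define Y where "Y k i = y k i - ys" for k i
  define Z where "Z k i = z k i - zs" for k i
  define U where "U k i = u k i - us i" for k i
  have eqs: "algorithm_equations S Fx Fu Lap x y z u v" and u: "\<And>k i. u k i = grad_row (f i) (y k i)"
    using traj by (auto simp: trajectory_def)
  have X: "X (Suc k) i = A ** X k i + (Bu ** U k i + Bv ** v k i)"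
    and Y: "Y k i = Cy ** X k i + (Dyu ** U k i + Dyv ** v k i)"
    and Z: "Z k i = Cz ** X k i + (Dzu ** U k i + Dzv ** v k i)" for k i
  proof -
    have "(x (Suc k) i === y k i === z k i) = S ** (x k i === u k i === v k i)"
      and "(xs i === ys === zs) = S ** (xs i === us i === 0)"
      using eqs eqs_star by (simp_all add: algorithm_equations_def)
    then have "(x (Suc k) i === y k i === z k i) - (xs i === ys === zs)
        = S ** ((x k i === u k i === v k i) - (xs i === us i === 0))"
      by (simp only: matrix_mult_diff_right)
    then have "(X (Suc k) i === Y k i === Z k i) = S ** (X k i === U k i === v k i)"
      by (simp only: vcat_diff X_def Y_def Z_def U_def diff_zero)
    then show "X (Suc k) i = A ** X k i + (Bu ** U k i + Bv ** v k i)"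
      and "Y k i = Cy ** X k i + (Dyu ** U k i + Dyv ** v k i)"
      and "Z k i = Cz ** X k i + (Dzu ** U k i + Dzv ** v k i)"
      by (simp_all add: S_def vcat_mult hcat_mult_vcat vcat_eq_iff)
  qed
  have v: "v k i = (\<Sum>j\<in>UNIV. Lap k $ i $ j *\<^sub>R z k j)" for k i
    using eqs by (simp add: algorithm_equations_def)
  have v_mean: "mean (v k) = 0" for k
    by (simp add: mean_def v sum_Laplacian_balanced[OF bal])
  \<comment> \<open>The Laplacian annihilates \<open>zs\<close> and the mean, so \<open>v\<close> is
    driven by the disagreement of \<open>Z\<close>, a family with sum zero.\<close>
  have v_perp: "v k i = (\<Sum>j\<in>UNIV. Lap k $ i $ j *\<^sub>R (Z k j - mean (Z k)))" for k i
    by (simp add: v Z_def scaleR_diff_right sum_subtractf Laplacian_const[OF Lap1])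
  have mean_X: "mean (X (Suc k)) = A ** mean (X k) + Bu ** mean (U k)"
    and mean_Y: "mean (Y k) = Cy ** mean (X k) + Dyu ** mean (U k)"
    and mean_Z: "mean (Z k) = Cz ** mean (X k) + Dzu ** mean (U k)" for k
    by (rule mean_output; fact X Y Z v_mean)+
  \<comment> \<open>The constraint holds along the trajectory and at the fixed point; the
    difference, divided by the number of agents, involves the averages alone.\<close>
  have invariant: "Fx ** mean (X k) + Fu ** mean (U k) = 0" for k
  proof -
    have "(\<Sum>j\<in>UNIV. Fx ** x k j + Fu ** u k j) = 0" "(\<Sum>j\<in>UNIV. Fx ** xs j + Fu ** us j) = 0"
      using eqs eqs_star by (simp_all add: algorithm_equations_def)
    then have "mean (\<lambda>i. Fx ** X k i + Fu ** U k i) = 0"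
      by (simp add: mean_def X_def U_def matrix_mult_diff_right sum.distrib sum_subtractf
          add_diff_add[symmetric])
    then show ?thesis by (simp add: mean_add mean_matrix_mult)
  qed

  have "lyapunov P Q (X (Suc k)) \<le> \<rho>\<^sup>2 * lyapunov P Q (X k)" for k
  proof (rule lyapunov_decrease)
    show "quadform P (mean (X (Suc k))) + quadform (M0 m L) (mean (Y k) === mean (U k))
        \<le> \<rho>\<^sup>2 * quadform P (mean (X k))"
      unfolding mean_X mean_Y
      by (rule consensus_lmi_quadform[OF basis lmi_1[unfolded T1_def] invariant])
    show "quadform Q (X (Suc k) i - mean (X (Suc k)))
        + quadform (M0 m L) (Y k i - mean (Y k) === U k i - mean (U k))
        + quadform (kronecker2 (M1 \<sigma>) R) (Z k i - mean (Z k) === v k i)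
        \<le> \<rho>\<^sup>2 * quadform Q (X k i - mean (X k))" for i
    proof -
      \<comment> \<open>Subtracting the averaged system leaves the same system for the disagreement,
        with all of \<open>v k i\<close> because \<open>v\<close> has mean zero.\<close>
      have "X (Suc k) i - mean (X (Suc k))
            = A ** (X k i - mean (X k)) + (Bu ** (U k i - mean (U k)) + Bv ** v k i)"
        and "Y k i - mean (Y k)
            = Cy ** (X k i - mean (X k)) + (Dyu ** (U k i - mean (U k)) + Dyv ** v k i)"
        and "Z k i - mean (Z k)
            = Cz ** (X k i - mean (X k)) + (Dzu ** (U k i - mean (U k)) + Dzv ** v k i)"
        by (simp_all add: X[of k i] Y[of k i] Z[of k i] mean_X mean_Y mean_Z
            matrix_mult_diff_right)
      then show ?thesis
        using disagreement_lmi_quadform[OF lmi_2[unfolded T2_def],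
            of "X k i - mean (X k)" "U k i - mean (U k)" "v k i"] by simp
    qed
    show "0 \<le> quadform (M0 m L) (Y k i === U k i)" for i
      unfolding Y_def U_def u us_def ys_def by (rule sector_quadform_nonneg[OF local_functions])
    show "0 \<le> (\<Sum>i\<in>UNIV. quadform (kronecker2 (M1 \<sigma>) R) (Z k i - mean (Z k) === v k i))"
      unfolding v_perp by (rule Laplacian_quadform_nonneg[OF R W sum_diff_mean])
  qed
  from geometric_decay[of "\<lambda>k. lyapunov P Q (X k)", OF this]
  have decay: "lyapunov P Q (X k) \<le> (\<rho> ^ k)\<^sup>2 * lyapunov P Q (X 0)" for k .
  obtain \<delta> where \<delta>: "\<delta> > 0"
    "\<And>(X :: 'n \<Rightarrow> real ^ 'd ^ 'p) i. \<delta> * (norm (X i))\<^sup>2 \<le> lyapunov P Q X"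
    using lyapunov_coercive[OF P Q] by metis
  \<comment> \<open>Chosen so that \<open>\<delta> * c^2\<close> is the initial Lyapunov value;
    coercivity and decay then bound the norms by \<open>c * \<rho> ^ k\<close>.\<close>
  define c where "c = sqrt (lyapunov P Q (X 0) / \<delta>)"
  have V0: "0 \<le> lyapunov P Q (X 0)"
    using \<delta>(1) by (intro order_trans[OF _ \<delta>(2)]) simp
  have c: "0 \<le> c" "\<delta> * c\<^sup>2 = lyapunov P Q (X 0)"
    using \<delta>(1) V0 by (simp_all add: c_def)
  \<comment> \<open>Adding 1 keeps the constant positive for a trajectory that starts at the fixed
    point, where \<open>c = 0\<close>.\<close>
  have "norm (x k i - xs i) \<le> (c + 1) * \<rho> ^ k" for k i
  proof -
    have "\<delta> * (norm (X k i))\<^sup>2 \<le> lyapunov P Q (X k)"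
      by (rule \<delta>(2))
    also have "\<dots> \<le> (\<rho> ^ k)\<^sup>2 * lyapunov P Q (X 0)"
      by (rule decay)
    also have "\<dots> = \<delta> * (c * \<rho> ^ k)\<^sup>2"
      unfolding c(2)[symmetric] power_mult_distrib by (simp only: ac_simps)
    finally have "(norm (X k i))\<^sup>2 \<le> (c * \<rho> ^ k)\<^sup>2"
      using \<delta>(1) by (simp only: mult_le_cancel_left_pos)
    then have "norm (X k i) \<le> c * \<rho> ^ k"
      by (rule power2_le_imp_le) (simp add: c(1) rate)
    also have "\<dots> \<le> (c + 1) * \<rho> ^ k"
      using rate by (simp add: mult_right_mono)
    finally show ?thesis by (simp add: X_def)
  qed
  moreover have "consensus_optimal (\<lambda>_. ys) us" "robust_to_graph (\<lambda>_ :: 'n. zs) (\<lambda>_. 0)"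
    using us0 by (simp_all add: consensus_optimal_def robust_to_graph_def)
  moreover have "c + 1 > 0" using c(1) by simp
  ultimately show ?thesis
    using fp robust ys_def us_def by blast
qed

end
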